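(* Let $d,k\ge 1$. For every $n\ge 2$, the group $\mathrm{RTM}(\mathbb{Z}^d,n,k)$ of reversible Turing machines is not finitely generated.
   Context: Let $\Sigma=\{0,\dots,n-1\}$ (tape symbols), $Q=\{1,\dots,k\}$ (states). The shift on $\Sigma^{\mathbb{Z}^d}$ is $(\sigma^{v}(x))_{u}=x_{u-v}$. A moving head $(\mathbb{Z}^d,n,k)$-Turing machine is a map $T:\Sigma^{\mathbb{Z}^d}\times Q\times\mathbb{Z}^d\to\Sigma^{\mathbb{Z}^d}\times Q\times\mathbb{Z}^d$ (a triple is tape, state, head position) for which there are finite sets $F_{\rm in},F_{\rm out}\subset\mathbb{Z}^d$ and a function $f:\Sigma^{F_{\rm in}}\times Q\to\Sigma^{F_{\rm out}}\times Q\times\mathbb{Z}^d$ such that $T(x,q,v)=(\tilde x,\tilde q,v+\tilde u)$, where $(\tilde p,\tilde q,\tilde u)=f(\sigma^{-v}(x)|_{F_{\rm in}},q)$, and $\tilde x_{u}=\tilde p_{u-v}$ if $u-v\in F_{\rm out}$, $\tilde x_u=x_u$ otherwise. $T$ is reversible if there is a $(\mathbb{Z}^d,n,k)$-Turing machine $T^{-1}$ with $T\circ T^{-1}=T^{-1}\circ T=\mathrm{id}$. $\mathrm{RTM}(\mathbb{Z}^d,n,k)$ is the group of reversible $(\mathbb{Z}^d,n,k)$-Turing machines under composition. *)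

theory Defs
  imports "HOL-Analysis.Finite_Cartesian_Product" "HOL-Algebra.Generated_Groups"
begin

text \<open>
  The lattice $Z^d$ is the type \<open>int ^ 'd\<close> with \<open>'d\<close> finite, so that
  \<open>d = CARD('d) \<ge> 1\<close>.  Tape symbols and states are natural numbers; the alphabet and the
  state set are the explicit carriers \<open>symbols n\<close> and \<open>states k\<close>.
\<close>

type_synonym 'd tape = "(int ^ 'd) \<Rightarrow> nat"
type_synonym 'd config = "'d tape \<times> nat \<times> (int ^ 'd)"
type_synonym 'd rule = "'d tape \<times> nat \<Rightarrow> 'd tape \<times> nat \<times> (int ^ 'd)"

definition symbols :: "nat \<Rightarrow> nat set" where
  "symbols n = {0..<n}"

definition states :: "nat \<Rightarrow> nat set" where
  "states k = {1..k}"

definition shift :: "(int ^ 'd::finite) \<Rightarrow> 'd tape \<Rightarrow> 'd tape" where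
  "shift v x = (\<lambda>u. x (u - v))"

definition configs :: "nat \<Rightarrow> nat \<Rightarrow> 'd::finite config set" where
  "configs n k = (UNIV \<rightarrow>\<^sub>E symbols n) \<times> states k \<times> UNIV"

text \<open>
  A pattern on a finite set \<open>F\<close> is an element of \<open>F \<rightarrow>\<^sub>E symbols n\<close>, that is, a function on
  the whole lattice that is \<open>undefined\<close> outside \<open>F\<close>.
\<close>

definition local_rules ::
    "nat \<Rightarrow> nat \<Rightarrow> (int ^ 'd::finite) set \<Rightarrow> (int ^ 'd) set \<Rightarrow> 'd rule set" where
  "local_rules n k F_in F_out =
     (F_in \<rightarrow>\<^sub>E symbols n) \<times> states k \<rightarrow> (F_out \<rightarrow>\<^sub>E symbols n) \<times> states k \<times> UNIV"

fun apply_rule ::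
    "(int ^ 'd::finite) set \<Rightarrow> (int ^ 'd) set \<Rightarrow> 'd rule \<Rightarrow> 'd config \<Rightarrow> 'd config" where
  "apply_rule F_in F_out f (x, q, v) =
     (let (p', q', u') = f (restrict (shift (- v) x) F_in, q)
      in (\<lambda>u. if u - v \<in> F_out then p' (u - v) else x u, q', v + u'))"

text \<open>
  Machines are extensional functions on the set of configurations, as in
  HOL-Algebra's theory of bijections (\<open>BijGroup\<close>), so that equality of machines is equality on configurations.
\<close>

definition turing_machines :: "nat \<Rightarrow> nat \<Rightarrow> ('d::finite config \<Rightarrow> 'd config) set" where
  "turing_machines n k =
     {T \<in> configs n k \<rightarrow>\<^sub>E configs n k.
        \<exists>F_in F_out f. finite F_in \<and> finite F_out \<and> f \<in> local_rules n k F_in F_out \<and>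
          (\<forall>c\<in>configs n k. T c = apply_rule F_in F_out f c)}"

definition reversible_turing_machines ::
    "nat \<Rightarrow> nat \<Rightarrow> ('d::finite config \<Rightarrow> 'd config) set" where
  "reversible_turing_machines n k =
     {T \<in> turing_machines n k. \<exists>T' \<in> turing_machines n k.
        compose (configs n k) T T' = (\<lambda>c\<in>configs n k. c) \<and>
        compose (configs n k) T' T = (\<lambda>c\<in>configs n k. c)}"

definition RTM :: "'d::finite itself \<Rightarrow> nat \<Rightarrow> nat \<Rightarrow> ('d config \<Rightarrow> 'd config) monoid" where
  "RTM _ n k =
     \<lparr>carrier = reversible_turing_machines n k,
      mult = (\<lambda>T1 T2. compose (configs n k) T1 T2),
      one = (\<lambda>c\<in>configs n k. c)\<rparr>"

definition finitely_generated_group :: "('a, 'b) monoid_scheme \<Rightarrow> bool" where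
  "finitely_generated_group G \<longleftrightarrow>
     (\<exists>S. finite S \<and> S \<subseteq> carrier G \<and> generate G S = carrier G)"


text \<open>
  The rest shows that \<^const>\<open>RTM\<close> is a group.
\<close>

lemma apply_rule_closed:
  assumes "f \<in> local_rules n k F_in F_out" "c \<in> configs n k"
  shows "apply_rule F_in F_out f c \<in> configs n k"
proof -
  obtain x q v where c: "c = (x, q, v)" by (cases c)
  have x: "x \<in> UNIV \<rightarrow>\<^sub>E symbols n" and q: "q \<in> states k"
    using assms(2) by (auto simp: c configs_def)
  have "restrict (shift (- v) x) F_in \<in> F_in \<rightarrow>\<^sub>E symbols n"
    using x by (auto simp: shift_def)
  then have *: "f (restrict (shift (- v) x) F_in, q) \<in> (F_out \<rightarrow>\<^sub>E symbols n) \<times> states k \<times> UNIV"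
    using assms(1) q unfolding local_rules_def by blast
  obtain p' q' u' where f: "f (restrict (shift (- v) x) F_in, q) = (p', q', u')"
    by (metis prod_cases3)
  show ?thesis using * x by (auto simp: c f configs_def PiE_iff)
qed

lemma compose_turing_machines:
  assumes n: "n \<ge> 1"
    and S: "S \<in> turing_machines n k" and T: "T \<in> turing_machines n k"
  shows "compose (configs n k) S T \<in> turing_machines n k"
proof -
  obtain A1 B1 f1 where 1: "finite A1" "finite B1" "f1 \<in> local_rules n k A1 B1"
    "\<And>c. c \<in> configs n k \<Longrightarrow> T c = apply_rule A1 B1 f1 c"
    using T unfolding turing_machines_def by blast
  obtain A2 B2 f2 where 2: "finite A2" "finite B2" "f2 \<in> local_rules n k A2 B2"
    "\<And>c. c \<in> configs n k \<Longrightarrow> S c = apply_rule A2 B2 f2 c"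
    using S unfolding turing_machines_def by blast
  have SC: "S \<in> configs n k \<rightarrow>\<^sub>E configs n k" and TC: "T \<in> configs n k \<rightarrow>\<^sub>E configs n k"
    using S T by (auto simp: turing_machines_def)
  define D where "D = (snd \<circ> snd \<circ> f1) ` ((A1 \<rightarrow>\<^sub>E symbols n) \<times> states k)"
  define F where "F = A1 \<union> B1 \<union> (\<Union>d\<in>D. (\<lambda>w. w + d) ` (A2 \<union> B2))"
  define ext where "ext p = (\<lambda>u. if u \<in> F then p u else (0::nat))" for p
  define g where "g = (\<lambda>(p, q). let (y, r, u) = apply_rule A2 B2 f2 (apply_rule A1 B1 f1 (ext p, q, 0))
                          in (restrict y F, r, u))"
  have finD: "finite D"
    unfolding D_def using 1(1)
    by (intro finite_imageI finite_cartesian_product finite_PiE) (auto simp: symbols_def states_def)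
  have finF: "finite F" using finD 1 2 by (auto simp: F_def)
  have inF: "w + d \<in> F" if "w \<in> A2 \<union> B2" "d \<in> D" for w d
    using that unfolding F_def by blast
  have g: "g \<in> local_rules n k F F"
    unfolding local_rules_def
  proof (rule funcsetI)
    fix c assume "c \<in> (F \<rightarrow>\<^sub>E symbols n) \<times> states k"
    then obtain p q where c: "c = (p, q)" and p: "p \<in> F \<rightarrow>\<^sub>E symbols n" and q: "q \<in> states k" by auto
    have "(ext p, q, 0) \<in> configs n k"
      using p q n by (auto simp: ext_def configs_def symbols_def)
    then have *: "apply_rule A2 B2 f2 (apply_rule A1 B1 f1 (ext p, q, 0)) \<in> configs n k"
      by (intro apply_rule_closed[OF 2(3)] apply_rule_closed[OF 1(3)])
    obtain y r u where y: "apply_rule A2 B2 f2 (apply_rule A1 B1 f1 (ext p, q, 0)) = (y, r, u)"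
      by (metis prod_cases3)
    show "g c \<in> (F \<rightarrow>\<^sub>E symbols n) \<times> states k \<times> UNIV"
    proof -
      have "g c = (restrict y F, r, u)"
        by (simp add: g_def c y del: apply_rule.simps)
      then show ?thesis using * unfolding y by (auto simp: configs_def)
    qed
  qed
  have eq: "S (T c) = apply_rule F F g c" if cC: "c \<in> configs n k" for c
  proof -
    obtain x q v where c: "c = (x, q, v)" by (cases c)
    have x: "x \<in> UNIV \<rightarrow>\<^sub>E symbols n" and q: "q \<in> states k"
      using cC by (auto simp: c configs_def)
    define z where "z = ext (restrict (shift (- v) x) F)"
    have z: "z w = x (w + v)" if "w \<in> F" for w
      using that by (simp add: z_def ext_def shift_def)
    have r1: "restrict (shift 0 z) A1 = restrict (shift (- v) x) A1"
      using z by (auto simp: restrict_def shift_def F_def fun_eq_iff)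
    obtain p1 q1 u1 where f1: "f1 (restrict (shift (- v) x) A1, q) = (p1, q1, u1)"
      by (metis prod_cases3)
    have "restrict (shift (- v) x) A1 \<in> A1 \<rightarrow>\<^sub>E symbols n"
      using x by (auto simp: shift_def)
    then have u1: "u1 \<in> D"
      using f1 q unfolding D_def
      by (intro image_eqI[of _ _ "(restrict (shift (- v) x) A1, q)"]) simp_all
    define y1 where "y1 = (\<lambda>u. if u - v \<in> B1 then p1 (u - v) else x u)"
    define z1 where "z1 = (\<lambda>u. if u \<in> B1 then p1 u else z u)"
    have T: "apply_rule A1 B1 f1 (x, q, v) = (y1, q1, v + u1)"
      by (simp add: f1 y1_def)
    have Tz: "apply_rule A1 B1 f1 (z, q, 0) = (z1, q1, u1)"
      by (simp add: r1 f1 z1_def cong: if_cong)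
    have z1: "z1 w = y1 (w + v)" if "w \<in> F" for w
      using z that by (auto simp: z1_def y1_def)
    have r2: "restrict (shift (- u1) z1) A2 = restrict (shift (- (v + u1)) y1) A2"
    proof (rule restrict_ext)
      fix w assume "w \<in> A2"
      then have "w + u1 \<in> F" using u1 inF by blast
      then show "shift (- u1) z1 w = shift (- (v + u1)) y1 w"
        using z1 by (simp add: shift_def algebra_simps)
    qed
    obtain p2 q2 u2 where f2: "f2 (restrict (shift (- (v + u1)) y1) A2, q1) = (p2, q2, u2)"
      by (metis prod_cases3)
    define y2 where "y2 = (\<lambda>u. if u - (v + u1) \<in> B2 then p2 (u - (v + u1)) else y1 u)"
    define z2 where "z2 = (\<lambda>u. if u - u1 \<in> B2 then p2 (u - u1) else z1 u)"
    have S: "apply_rule A2 B2 f2 (y1, q1, v + u1) = (y2, q2, v + u1 + u2)"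
      using f2 by (simp add: y2_def)
    have Sz: "apply_rule A2 B2 f2 (z1, q1, u1) = (z2, q2, u1 + u2)"
      using f2 by (simp add: r2 z2_def)
    have gz: "g (restrict (shift (- v) x) F, q) = (restrict z2 F, q2, u1 + u2)"
      by (simp add: g_def z_def[symmetric] Tz Sz del: apply_rule.simps)
    have y2: "y2 u = (if u - v \<in> F then restrict z2 F (u - v) else x u)" for u
    proof (cases "u - v \<in> F")
      case True
      then show ?thesis using z1[OF True] by (simp add: y2_def z2_def diff_diff_eq)
    next
      case False
      have "u - v \<notin> B1" using False by (auto simp: F_def)
      moreover have "u - (v + u1) \<notin> B2"
        using False inF[OF _ u1, of "u - (v + u1)"] by (auto simp: algebra_simps)
      ultimately show ?thesis using False by (simp add: y2_def y1_def)
    qed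
    have "S (T c) = (y2, q2, v + u1 + u2)"
      using cC TC 1(4) 2(4) T S by (metis PiE_mem c)
    also have "\<dots> = apply_rule F F g c"
      using y2 by (auto simp: c gz add.assoc)
    finally show ?thesis .
  qed
  have "compose (configs n k) S T \<in> configs n k \<rightarrow>\<^sub>E configs n k"
    using SC TC by (auto simp: compose_def)
  then show ?thesis
    unfolding turing_machines_def using finF g eq by (auto simp: compose_eq)
qed

lemma id_turing_machine: "(\<lambda>c\<in>configs n k. c) \<in> turing_machines n k"
proof -
  define g :: "'a rule" where "g = (\<lambda>(p, q). (p, q, 0))"
  have "g \<in> local_rules n k {} {}"
    by (auto simp: g_def local_rules_def)
  moreover have "apply_rule {} {} g c = c" for c
    by (cases c) (simp add: g_def)
  ultimately show ?thesis
    unfolding turing_machines_def by (auto intro!: exI[of _ "{}"] exI[of _ g])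
qed

theorem group_RTM:
  assumes "n \<ge> 1"
  shows "group (RTM TYPE('d::finite) n k)"
proof (rule groupI, unfold RTM_def monoid.simps partial_object.simps)
  let ?C = "configs n k :: 'd config set" and ?R = "reversible_turing_machines n k :: ('d config \<Rightarrow> 'd config) set"
  have map: "T \<in> ?C \<rightarrow> ?C" "T \<in> extensional ?C" if "T \<in> turing_machines n k" for T
    using that by (auto simp: turing_machines_def PiE_def)
  have R: "T \<in> turing_machines n k" if "T \<in> ?R" for T
    using that by (simp add: reversible_turing_machines_def)
  show "(\<lambda>c\<in>?C. c) \<in> ?R"
  proof -
    have "compose ?C (\<lambda>c\<in>?C. c) (\<lambda>c\<in>?C. c) = (\<lambda>c\<in>?C. c)"
      by (auto simp: compose_def fun_eq_iff)
    then show ?thesis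
      unfolding reversible_turing_machines_def using id_turing_machine by blast
  qed
  show assoc: "compose ?C (compose ?C S T) U = compose ?C S (compose ?C T U)"
    if "S \<in> ?R" "T \<in> ?R" "U \<in> ?R" for S T U
    using map(1)[OF R] that by (metis compose_assoc)
  show "compose ?C (\<lambda>c\<in>?C. c) T = T" if "T \<in> ?R" for T
    using map[OF R[OF that]] by (simp add: Id_compose)
  show "\<exists>T'\<in>?R. compose ?C T' T = (\<lambda>c\<in>?C. c)" if "T \<in> ?R" for T
    using that by (auto simp: reversible_turing_machines_def)
  show "compose ?C S T \<in> ?R" if ST: "S \<in> ?R" "T \<in> ?R" for S T
  proof -
    obtain S' where S': "S' \<in> turing_machines n k"
      "compose ?C S S' = (\<lambda>c\<in>?C. c)" "compose ?C S' S = (\<lambda>c\<in>?C. c)"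
      using ST(1) unfolding reversible_turing_machines_def by blast
    obtain T' where T': "T' \<in> turing_machines n k"
      "compose ?C T T' = (\<lambda>c\<in>?C. c)" "compose ?C T' T = (\<lambda>c\<in>?C. c)"
      using ST(2) unfolding reversible_turing_machines_def by blast
    have cancel: "compose ?C (compose ?C U V) (compose ?C V' U') = (\<lambda>c\<in>?C. c)"
      if "U' \<in> ?C \<rightarrow> ?C" "V' \<in> ?C \<rightarrow> ?C"
        "compose ?C U U' = (\<lambda>c\<in>?C. c)" "compose ?C V V' = (\<lambda>c\<in>?C. c)" for U V U' V'
    proof
      fix c
      show "compose ?C (compose ?C U V) (compose ?C V' U') c = (\<lambda>c\<in>?C. c) c"
      proof (cases "c \<in> ?C")
        case True
        then have "U' c \<in> ?C" "V' (U' c) \<in> ?C" using that(1,2) by auto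
        then show ?thesis
          using True fun_cong[OF that(3), of c] fun_cong[OF that(4), of "U' c"]
          by (simp add: compose_eq)
      qed (simp add: compose_def)
    qed
    show ?thesis
      unfolding reversible_turing_machines_def mem_Collect_eq
    proof (intro conjI bexI)
      show "compose ?C S T \<in> turing_machines n k" "compose ?C T' S' \<in> turing_machines n k"
        using assms R ST S' T' compose_turing_machines by blast+
      show "compose ?C (compose ?C S T) (compose ?C T' S') = (\<lambda>c\<in>?C. c)"
        "compose ?C (compose ?C T' S') (compose ?C S T) = (\<lambda>c\<in>?C. c)"
        using cancel map(1) R ST S' T' by blast+
    qed
  qed
qed

end

theory Submission
  imports Defs
begin

text \<open>
  Fix a coordinate axis \<open>j\<close>.  Put the head at the origin, choose every cell and the state
  independently and uniformly, and call the expected displacement of the head along \<open>j\<close> in one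
  step the drift of a machine.  Three properties of the drift make finite generation impossible.

  The drift is rational, because the displacement depends on finitely many cells: it is an average
  over the finitely many patterns on a window.

  The drift is additive on reversible machines (\<open>drift_compose\<close>).  Indeed the displacement of
  \<open>S \<circ> T\<close> at \<open>c\<close> is that of \<open>T\<close> at \<open>c\<close> plus that of \<open>S\<close> at \<open>T c\<close>, and a reversible \<open>T\<close>, seen from
  the head, preserves the uniform distribution.  The preservation is a counting fact
  (\<open>window_sum_machine\<close>): once a window \<open>W\<close> is large, \<open>T\<close> maps the cylinder of all tapes with a given
  content on \<open>W\<close> onto a cylinder over a translate of \<open>W\<close>, which is just as large, and bijectivity
  says that the image cylinders partition the configurations.  Hence the drifts of a finitely
  generated group of reversible machines have a common denominator.

  The drifts of all reversible machines have no common denominator (\<open>drift_glider\<close>).  The glider of length \<open>m\<close> acts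
  only if the \<open>m\<close> cells starting at the head all contain 0.  It then carries this block of zeros
  along one step: the symbol just after the block moves to the place just behind it, and the head
  advances by one.  The block is still under the head afterwards, so that the move can be undone.
  The block appears with probability \<open>1 / n ^ m\<close>, which is therefore the drift.
\<close>

section \<open>Tapes with finitely many free cells\<close>

definition free_tapes :: "nat \<Rightarrow> (int ^ 'd::finite) set \<Rightarrow> 'd tape \<Rightarrow> 'd tape set" where
  "free_tapes n W s = {z. \<forall>a. if a \<in> W then z a \<in> symbols n else z a = s a}"

lemma free_tapes_outside: "z \<in> free_tapes n W s \<Longrightarrow> a \<notin> W \<Longrightarrow> z a = s a"
  unfolding free_tapes_def by (auto dest: spec[of _ a])

lemma bij_betw_free_tapes: "bij_betw (\<lambda>z. restrict z W) (free_tapes n W s) (W \<rightarrow>\<^sub>E symbols n)"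
proof (rule bij_betwI[where g = "\<lambda>p a. if a \<in> W then p a else s a"])
  show "(\<lambda>z. restrict z W) \<in> free_tapes n W s \<rightarrow> W \<rightarrow>\<^sub>E symbols n"
    by (auto simp: free_tapes_def)
  show "(\<lambda>p a. if a \<in> W then p a else s a) \<in> (W \<rightarrow>\<^sub>E symbols n) \<rightarrow> free_tapes n W s"
    by (auto simp: free_tapes_def)
  show "(\<lambda>a. if a \<in> W then restrict z W a else s a) = z" if "z \<in> free_tapes n W s" for z
    using that by (auto simp: free_tapes_def fun_eq_iff)
  show "restrict (\<lambda>a. if a \<in> W then p a else s a) W = p" if "p \<in> W \<rightarrow>\<^sub>E symbols n" for p
    using that by (auto simp: fun_eq_iff PiE_def extensional_def)
qed

lemma finite_free_tapes: "finite W \<Longrightarrow> finite (free_tapes n W s)"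
  using bij_betw_finite[OF bij_betw_free_tapes[of W n s]]
  by (simp add: finite_PiE symbols_def)

lemma card_free_tapes: "finite W \<Longrightarrow> card (free_tapes n W s) = n ^ card W"
  using bij_betw_same_card[OF bij_betw_free_tapes[of W n s]]
  by (simp add: card_PiE symbols_def)

text \<open>
  The value 0 outside the window is a representative only: window configurations are used to evaluate
  functions that depend on nothing outside \<open>W\<close>.
\<close>

definition window_configs :: "nat \<Rightarrow> nat \<Rightarrow> (int ^ 'd::finite) set \<Rightarrow> 'd config set" where
  "window_configs n k W = free_tapes n W (\<lambda>_. 0) \<times> states k \<times> {0}"

lemma finite_window_configs: "finite W \<Longrightarrow> finite (window_configs n k W)"
  by (simp add: window_configs_def finite_free_tapes states_def)

lemma card_window_configs: "finite W \<Longrightarrow> card (window_configs n k W) = n ^ card W * k"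
  by (simp add: window_configs_def card_free_tapes states_def card_cartesian_product)

lemma mem_configs: "(x, q, v) \<in> configs n k \<longleftrightarrow> (\<forall>a. x a \<in> symbols n) \<and> q \<in> states k"
  by (auto simp: configs_def)

lemma free_tapes_symbols:
  assumes "z \<in> free_tapes n W s" "\<And>a. a \<notin> W \<Longrightarrow> s a \<in> symbols n"
  shows "z a \<in> symbols n"
  using assms by (cases "a \<in> W") (auto simp: free_tapes_def split: if_splits)

lemma window_configs_subset: "n \<ge> 1 \<Longrightarrow> window_configs n k W \<subseteq> configs n k"
  using free_tapes_symbols[of _ n W "\<lambda>_. 0"]
  by (auto simp: window_configs_def mem_configs symbols_def)

section \<open>Translation invariance and locality\<close>

fun translate :: "(int ^ 'd::finite) \<Rightarrow> 'd config \<Rightarrow> 'd config" where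
  "translate a (x, q, v) = (shift a x, q, v + a)"

lemma translate_configs: "c \<in> configs n k \<Longrightarrow> translate a c \<in> configs n k"
  by (cases c) (simp add: mem_configs shift_def)

lemma translate_translate: "translate a (translate b c) = translate (a + b) c"
  by (cases c) (simp add: shift_def algebra_simps)

lemma translate_0: "translate 0 c = c"
  by (cases c) (simp add: shift_def)

lemma machine_translate:
  assumes "T \<in> turing_machines n k" "c \<in> configs n k"
  shows "T (translate a c) = translate a (T c)"
proof -
  obtain A B f where T: "\<And>c. c \<in> configs n k \<Longrightarrow> T c = apply_rule A B f c"
    using assms(1) unfolding turing_machines_def by blast
  obtain x q v where c: "c = (x, q, v)" by (cases c)
  have "shift (- (v + a)) (shift a x) = shift (- v) x"
    by (auto simp: shift_def algebra_simps fun_eq_iff)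
  then have "apply_rule A B f (translate a c) = translate a (apply_rule A B f c)"
    by (auto simp: c shift_def algebra_simps split: prod.splits)
  then show ?thesis
    using assms(2) by (simp add: T translate_configs del: apply_rule.simps)
qed

text \<open>
  What the counting argument retains of a local rule: the sets \<open>F\<close> of cells read or written and \<open>M\<close>
  of possible moves.  Taking \<open>x' = x\<close> shows that cells outside \<open>F\<close> keep their symbols.
\<close>

definition machine_window ::
  "nat \<Rightarrow> nat \<Rightarrow> ('d::finite config \<Rightarrow> 'd config) \<Rightarrow> (int ^ 'd) set \<Rightarrow> (int ^ 'd) set \<Rightarrow> bool" where
  "machine_window n k T F M \<longleftrightarrow>
     (\<forall>x q y q' u. (x, q, 0) \<in> configs n k \<longrightarrow> T (x, q, 0) = (y, q', u) \<longrightarrow>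
        u \<in> M \<and>
        (\<forall>x'. (x', q, 0) \<in> configs n k \<longrightarrow> (\<forall>a\<in>F. x' a = x a) \<longrightarrow>
           T (x', q, 0) = (\<lambda>a. if a \<in> F then y a else x' a, q', u)))"

lemma machine_window_exists:
  fixes T :: "'d::finite config \<Rightarrow> 'd config"
  assumes "T \<in> turing_machines n k"
  shows "\<exists>F M. finite F \<and> finite M \<and> machine_window n k T F M"
proof -
  obtain A B f where AB: "finite A" "finite B" and f: "f \<in> local_rules n k A B"
    and T: "\<And>c. c \<in> configs n k \<Longrightarrow> T c = apply_rule A B f c"
    using assms unfolding turing_machines_def by blast
  define M where "M = (snd \<circ> snd \<circ> f) ` ((A \<rightarrow>\<^sub>E symbols n) \<times> states k)"
  have "finite M"
    unfolding M_def using AB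
    by (intro finite_imageI finite_cartesian_product finite_PiE) (auto simp: symbols_def states_def)
  moreover have "machine_window n k T (A \<union> B) M"
    unfolding machine_window_def
  proof (intro allI impI)
    fix x q y q' u
    assume c: "(x, q, 0) \<in> configs n k" and Tc: "T (x, q, 0) = (y, q', u)"
    obtain p r w where p: "f (restrict x A, q) = (p, r, w)" by (metis prod_cases3)
    have sh: "shift 0 z = z" for z :: "'d tape" by (simp add: shift_def)
    have yq: "y = (\<lambda>a. if a \<in> B then p a else x a)" "q' = r" "u = w"
      using Tc c by (auto simp: T p sh)
    have "(restrict x A, q) \<in> (A \<rightarrow>\<^sub>E symbols n) \<times> states k"
      using c by (auto simp: mem_configs)
    then have "u \<in> M"
      unfolding M_def by (rule image_eqI[rotated]) (simp add: p yq)
    moreover have "T (x', q, 0) = (\<lambda>a. if a \<in> A \<union> B then y a else x' a, q', u)"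
      if c': "(x', q, 0) \<in> configs n k" and ag: "\<forall>a\<in>A \<union> B. x' a = x a" for x'
    proof -
      have "restrict x' A = restrict x A" using ag by (auto simp: restrict_def)
      then show ?thesis using c' ag by (auto simp: T sh p yq)
    qed
    ultimately show "u \<in> M \<and> (\<forall>x'. (x', q, 0) \<in> configs n k \<longrightarrow> (\<forall>a\<in>A \<union> B. x' a = x a) \<longrightarrow>
           T (x', q, 0) = (\<lambda>a. if a \<in> A \<union> B then y a else x' a, q', u))" by blast
  qed
  ultimately show ?thesis using AB by blast
qed

lemma machine_window_move:
  "\<lbrakk>machine_window n k T F M; (x, q, 0) \<in> configs n k; T (x, q, 0) = (y, q', u)\<rbrakk> \<Longrightarrow> u \<in> M"
  unfolding machine_window_def by blast

text \<open>
  Enlarging the set of cells read or written is harmless, since the added cells are left alone.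
\<close>

lemma machine_window_agree:
  assumes "machine_window n k T F M" "F \<subseteq> W"
    and "(x, q, 0) \<in> configs n k" "T (x, q, 0) = (y, q', u)"
    and "(x', q, 0) \<in> configs n k" "\<And>a. a \<in> W \<Longrightarrow> x' a = x a"
  shows "T (x', q, 0) = (\<lambda>a. if a \<in> W then y a else x' a, q', u)"
proof -
  have "T (x', q, 0) = (\<lambda>a. if a \<in> F then y a else x' a, q', u)"
    "T (x, q, 0) = (\<lambda>a. if a \<in> F then y a else x a, q', u)"
    using assms unfolding machine_window_def by (blast, blast)
  moreover have "y a = x a" if "a \<notin> F" for a
    using calculation(2) assms(4) that by (auto dest: fun_cong[of _ _ a])
  ultimately show ?thesis using assms(2,6) by (auto simp: fun_eq_iff)
qed

text \<open>
  Invariance under translation is what allows \<open>\<phi>\<close> to be evaluated after a step that has moved the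
  head, without passing to a frame in which the head stays at the origin.
\<close>

definition local_observable ::
  "nat \<Rightarrow> nat \<Rightarrow> ('d::finite config \<Rightarrow> int) \<Rightarrow> (int ^ 'd) set \<Rightarrow> bool" where
  "local_observable n k \<phi> B \<longleftrightarrow>
     (\<forall>c\<in>configs n k. \<forall>a. \<phi> (translate a c) = \<phi> c) \<and>
     (\<forall>x x' q. (x, q, 0) \<in> configs n k \<longrightarrow> (x', q, 0) \<in> configs n k \<longrightarrow>
        (\<forall>b\<in>B. x b = x' b) \<longrightarrow> \<phi> (x, q, 0) = \<phi> (x', q, 0))"

section \<open>Invariance of window averages\<close>

definition window_mean :: "nat \<Rightarrow> nat \<Rightarrow> (int ^ 'd::finite) set \<Rightarrow> ('d config \<Rightarrow> int) \<Rightarrow> rat" where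
  "window_mean n k W \<phi> =
     (\<Sum>c\<in>window_configs n k W. of_int (\<phi> c)) / of_nat (card (window_configs n k W))"

text \<open>
  Reversible machines preserve the uniform distribution, in a form that only counts.  The map \<open>g\<close>
  below takes \<open>d\<close> to the pattern on \<open>W\<close> around the head one step earlier.  Its fibre over \<open>c\<close>
  is the image under \<open>T\<close> of the cylinder given by \<open>c\<close>, translated so that the head is at the origin:
  the cells of \<open>W - u\<close> are prescribed and the other cells of \<open>W'\<close> are free.  So all fibres have the
  same size, and \<open>\<phi>\<close>, whose window lies in \<open>W - u\<close>, is constant on each of them.
\<close>

lemma window_sum_machine:
  fixes T :: "'d::finite config \<Rightarrow> 'd config"
  assumes n: "n \<ge> 1"
    and T: "T \<in> turing_machines n k" and S: "S \<in> configs n k \<rightarrow> configs n k"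
    and TS: "\<And>c. c \<in> configs n k \<Longrightarrow> T (S c) = c" and ST: "\<And>c. c \<in> configs n k \<Longrightarrow> S (T c) = c"
    and win: "machine_window n k T F M" and obs: "local_observable n k \<phi> B"
    and W: "finite W" "F \<subseteq> W" "\<And>b u. b \<in> B \<Longrightarrow> u \<in> M \<Longrightarrow> b + u \<in> W"
    and W': "finite W'" "\<And>a u. a \<in> W \<Longrightarrow> u \<in> M \<Longrightarrow> a - u \<in> W'"
  shows "(\<Sum>d\<in>window_configs n k W'. \<phi> d)
    = int (n ^ (card W' - card W)) * (\<Sum>c\<in>window_configs n k W. \<phi> (T c))"
proof -
  let ?C = "configs n k" and ?X = "window_configs n k :: (int ^ 'd) set \<Rightarrow> 'd config set"
  define g :: "'d config \<Rightarrow> 'd config" where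
    "g d = (case S d of (x, q, v) \<Rightarrow> (\<lambda>a. if a \<in> W then x (a + v) else 0, q, 0))" for d
  note sub = window_configs_subset[OF n, of k]
  have g: "g ` ?X W' \<subseteq> ?X W"
  proof
    fix c assume "c \<in> g ` ?X W'"
    then obtain d where d: "d \<in> ?C" "c = g d" using sub by blast
    obtain x q v where Sd: "S d = (x, q, v)" by (cases "S d")
    have "(x, q, v) \<in> ?C" using S d Sd by (metis Pi_mem)
    then show "c \<in> ?X W"
      by (auto simp: d g_def Sd window_configs_def free_tapes_def mem_configs)
  qed
  have fibre: "(\<Sum>d\<in>{d \<in> ?X W'. g d = c}. \<phi> d) = int (n ^ (card W' - card W)) * \<phi> (T c)"
    if cW: "c \<in> ?X W" for c
  proof -
    obtain w q where c: "c = (w, q, 0)" and w: "w \<in> free_tapes n W (\<lambda>_. 0)"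
      using cW by (auto simp: window_configs_def)
    have cC: "(w, q, 0) \<in> ?C" using cW sub c by blast
    obtain y q' u where Tc: "T (w, q, 0) = (y, q', u)" by (cases "T (w, q, 0)")
    have TcC: "(y, q', u) \<in> ?C" using T cC Tc unfolding turing_machines_def by (metis (no_types, lifting) PiE_mem mem_Collect_eq)
    have u: "u \<in> M" using machine_window_move[OF win cC Tc] .
    define V where "V = (\<lambda>a. a - u) ` W"
    have V: "a \<in> V \<longleftrightarrow> a + u \<in> W" for a
      unfolding V_def by (metis (no_types, lifting) add_diff_cancel diff_add_cancel image_iff)
    have VW': "V \<subseteq> W'" using W'(2) u by (auto simp: V_def)
    have cardV: "card V = card W"
      unfolding V_def by (intro card_image inj_onI) simp
    define s where "s a = (if a \<in> V then y (a + u) else 0)" for a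
    define K where "K = free_tapes n (W' - V) s \<times> {q'} \<times> {0 :: int ^ 'd}"
    have s: "s a \<in> symbols n" for a
      using TcC n by (auto simp: s_def mem_configs symbols_def)
    \<comment> \<open>The head moves by \<open>u\<close> on the whole cylinder of \<open>c\<close>, so all its images have the tape of \<open>T c\<close>
      on \<open>W\<close>; translating the head back to the origin turns \<open>W\<close> into \<open>V\<close>.\<close>
    have "{d \<in> ?X W'. g d = c} = K"
    proof (intro subset_antisym subsetI)
      fix d assume "d \<in> {d \<in> ?X W'. g d = c}"
      then have dX: "d \<in> ?X W'" and gd: "g d = c" by auto
      then obtain z q1 where d: "d = (z, q1, 0)" and z: "z \<in> free_tapes n W' (\<lambda>_. 0)"
        by (auto simp: window_configs_def)
      have dC: "d \<in> ?C" using dX sub by blast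
      obtain x q2 v where Sd: "S d = (x, q2, v)" by (cases "S d")
      have q2: "q2 = q" and wx: "\<And>a. a \<in> W \<Longrightarrow> shift (- v) x a = w a"
        using gd by (auto simp: g_def Sd c shift_def)
      have SdC: "S d \<in> ?C" using S dC by blast
      have tr: "translate (- v) (S d) = (shift (- v) x, q, 0)" by (simp add: Sd q2)
      have "T (shift (- v) x, q, 0) = translate (- v) (T (S d))"
        using machine_translate[OF T SdC, of "- v"] by (simp only: tr)
      also have "\<dots> = (shift (- v) z, q1, - v)" by (simp add: TS dC) (simp add: d)
      finally have 1: "T (shift (- v) x, q, 0) = (shift (- v) z, q1, - v)" .
      have "T (shift (- v) x, q, 0) = (\<lambda>a. if a \<in> W then y a else shift (- v) x a, q', u)"
        using machine_window_agree[OF win W(2) cC Tc _ wx] translate_configs[OF SdC, of "- v"] tr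
        by simp
      with 1 have *: "q1 = q'" "v = - u" "shift (- v) z = (\<lambda>a. if a \<in> W then y a else shift (- v) x a)"
        by auto
      have "z a = y (a + u)" if "a \<in> V" for a
        using fun_cong[OF *(3), of "a + u"] that by (simp add: V *(2) shift_def)
      then show "d \<in> K"
        using z VW' by (auto simp: K_def d * free_tapes_def s_def)
    next
      fix d assume "d \<in> K"
      then obtain z where d: "d = (z, q', 0)" and z: "z \<in> free_tapes n (W' - V) s"
        by (auto simp: K_def)
      have zs: "z a \<in> symbols n" for a using free_tapes_symbols[OF z s] .
      have zy: "z (a - u) = y a" if "a \<in> W" for a
      proof -
        have "a - u \<in> V" using that by (simp add: V)
        then have "z (a - u) = s (a - u)" using z by (simp add: free_tapes_outside)
        then show ?thesis using \<open>a - u \<in> V\<close> by (simp add: s_def)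
      qed
      define x where "x a = (if a \<in> W then w a else z (a - u))" for a
      have xC: "(x, q, 0) \<in> ?C"
        using cC zs by (auto simp: mem_configs x_def)
      have "T (x, q, 0) = (\<lambda>a. if a \<in> W then y a else x a, q', u)"
        by (rule machine_window_agree[OF win W(2) cC Tc xC]) (simp add: x_def)
      also have "\<dots> = translate u d"
        by (auto simp: d x_def shift_def zy)
      finally have "T (translate (- u) (x, q, 0)) = d"
        using machine_translate[OF T xC, of "- u"] by (simp only: translate_translate) (simp add: translate_0)
      then have Sd: "S d = (shift (- u) x, q, - u)"
        using ST[OF translate_configs[OF xC, of "- u"]] by simp
      have "g d = c"
        using free_tapes_outside[OF w] by (auto simp: g_def Sd c shift_def x_def fun_eq_iff)
      moreover have "d \<in> ?X W'"
      proof -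
        have "z a = 0" if "a \<notin> W'" for a
          using free_tapes_outside[OF z, of a] that VW' by (auto simp: s_def)
        then show ?thesis
          using zs TcC by (auto simp: d window_configs_def free_tapes_def mem_configs)
      qed
      ultimately show "d \<in> {d \<in> ?X W'. g d = c}" by simp
    qed
    moreover have "\<phi> d = \<phi> (T c)" if dK: "d \<in> K" for d
    proof -
      obtain z where d: "d = (z, q', 0)" and z: "z \<in> free_tapes n (W' - V) s"
        using dK by (auto simp: K_def)
      have zs: "z a \<in> symbols n" for a using free_tapes_symbols[OF z s] .
      have "\<phi> (T c) = \<phi> (translate (- u) (y, q', u))"
        using obs TcC unfolding local_observable_def c Tc by metis
      also have "\<dots> = \<phi> (shift (- u) y, q', 0)" by simp
      also have "\<dots> = \<phi> (z, q', 0)"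
      proof -
        have "shift (- u) y b = z b" if "b \<in> B" for b
        proof -
          have "b \<in> V" using W(3) that u by (simp add: V)
          then have "z b = s b" using z by (simp add: free_tapes_outside)
          then show ?thesis using \<open>b \<in> V\<close> by (simp add: s_def shift_def)
        qed
        moreover have "(shift (- u) y, q', 0) \<in> ?C" "(z, q', 0) \<in> ?C"
          using TcC zs by (auto simp: mem_configs shift_def)
        ultimately show ?thesis using obs unfolding local_observable_def by blast
      qed
      finally show ?thesis by (simp add: d)
    qed
    moreover have "card K = n ^ (card W' - card W)"
      using VW' W'(1) cardV
      by (simp add: K_def card_cartesian_product card_free_tapes card_Diff_subset finite_subset)
    ultimately show ?thesis by simp
  qed
  have "(\<Sum>d\<in>?X W'. \<phi> d) = (\<Sum>c\<in>?X W. \<Sum>d\<in>{d \<in> ?X W'. g d = c}. \<phi> d)"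
    by (rule sum.group[symmetric]) (use W W' g finite_window_configs in auto)
  also have "\<dots> = (\<Sum>c\<in>?X W. int (n ^ (card W' - card W)) * \<phi> (T c))"
    using fibre by simp
  finally show ?thesis by (simp add: sum_distrib_left)
qed

lemma window_mean_machine:
  fixes T :: "'d::finite config \<Rightarrow> 'd config"
  assumes n: "n \<ge> 1"
    and T: "T \<in> turing_machines n k" and S: "S \<in> configs n k \<rightarrow> configs n k"
    and TS: "\<And>c. c \<in> configs n k \<Longrightarrow> T (S c) = c" and ST: "\<And>c. c \<in> configs n k \<Longrightarrow> S (T c) = c"
    and win: "machine_window n k T F M" and obs: "local_observable n k \<phi> B"
    and W: "finite W" "F \<subseteq> W" "\<And>b u. b \<in> B \<Longrightarrow> u \<in> M \<Longrightarrow> b + u \<in> W"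
    and W': "finite W'" "W \<subseteq> W'" "\<And>a u. a \<in> W \<Longrightarrow> u \<in> M \<Longrightarrow> a - u \<in> W'"
  shows "window_mean n k W (\<lambda>c. \<phi> (T c)) = window_mean n k W' \<phi>"
proof -
  have "card W \<le> card W'" using W' by (simp add: card_mono)
  then have "n ^ card W' = n ^ (card W' - card W) * n ^ card W"
    by (simp flip: power_add)
  moreover have "(\<Sum>c\<in>window_configs n k W'. rat_of_int (\<phi> c)) =
      of_nat (n ^ (card W' - card W)) * (\<Sum>c\<in>window_configs n k W. of_int (\<phi> (T c)))"
    using arg_cong[OF window_sum_machine[OF n T S TS ST win obs W W'(1,3)], of rat_of_int]
    by simp
  ultimately show ?thesis
    using n W(1) W'(1) by (simp add: window_mean_def card_window_configs field_simps)
qed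

text \<open>
  The expectation under the uniform distribution: for an observable that depends on finitely many
  cells the averages over windows do not merely converge but are eventually constant.
\<close>

definition has_mean :: "nat \<Rightarrow> nat \<Rightarrow> ('d::finite config \<Rightarrow> int) \<Rightarrow> rat \<Rightarrow> bool" where
  "has_mean n k \<phi> a \<longleftrightarrow>
     (\<exists>B. finite B \<and> (\<forall>W. finite W \<longrightarrow> B \<subseteq> W \<longrightarrow> window_mean n k W \<phi> = a))"

lemma has_mean_unique:
  assumes "has_mean n k \<phi> a" "has_mean n k \<phi> b"
  shows "a = b"
proof -
  obtain A B where "finite A" "\<And>W. finite W \<Longrightarrow> A \<subseteq> W \<Longrightarrow> window_mean n k W \<phi> = a"
    and "finite B" "\<And>W. finite W \<Longrightarrow> B \<subseteq> W \<Longrightarrow> window_mean n k W \<phi> = b"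
    using assms unfolding has_mean_def by blast
  from this(2)[of "A \<union> B"] this(4)[of "A \<union> B"] this(1,3) show ?thesis by simp
qed

lemma has_mean_add:
  assumes "has_mean n k \<phi> a" "has_mean n k \<psi> b"
  shows "has_mean n k (\<lambda>c. \<phi> c + \<psi> c) (a + b)"
proof -
  obtain A B where "finite A" "\<And>W. finite W \<Longrightarrow> A \<subseteq> W \<Longrightarrow> window_mean n k W \<phi> = a"
    and "finite B" "\<And>W. finite W \<Longrightarrow> B \<subseteq> W \<Longrightarrow> window_mean n k W \<psi> = b"
    using assms unfolding has_mean_def by blast
  moreover have "window_mean n k W (\<lambda>c. \<phi> c + \<psi> c) = window_mean n k W \<phi> + window_mean n k W \<psi>" for W
    by (simp add: window_mean_def sum.distrib add_divide_distrib)
  ultimately show ?thesis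
    unfolding has_mean_def by (intro exI[of _ "A \<union> B"]) auto
qed

lemma has_mean_cong:
  assumes "n \<ge> 1" "\<And>c. c \<in> configs n k \<Longrightarrow> \<phi> c = \<psi> c"
  shows "has_mean n k \<phi> a \<longleftrightarrow> has_mean n k \<psi> a"
proof -
  have "window_mean n k W \<phi> = window_mean n k W \<psi>" for W
    using window_configs_subset[OF assms(1), of k W] assms(2)
    by (auto simp: window_mean_def intro!: sum.cong arg_cong2[where f = "(/)"])
  then show ?thesis by (simp add: has_mean_def)
qed

text \<open>
  Independence of the window is the invariance of averages for the machine that does nothing.
\<close>

lemma has_mean_local_observable:
  fixes \<phi> :: "'d::finite config \<Rightarrow> int"
  assumes n: "n \<ge> 1" and obs: "local_observable n k \<phi> B" and B: "finite B"
  shows "has_mean n k \<phi> (window_mean n k B \<phi>)"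
  unfolding has_mean_def
proof (intro exI conjI allI impI)
  fix W assume W: "finite W" "B \<subseteq> W"
  let ?I = "\<lambda>c\<in>configs n k. c :: 'd config"
  have win: "machine_window n k ?I {} {0}"
    by (auto simp: machine_window_def)
  have "window_mean n k B \<phi> = window_mean n k B (\<lambda>c. \<phi> (?I c))"
    using window_configs_subset[OF n, of k B]
    by (auto simp: window_mean_def intro!: sum.cong arg_cong2[where f = "(/)"])
  also have "\<dots> = window_mean n k W \<phi>"
    by (rule window_mean_machine[OF n id_turing_machine _ _ _ win obs, of ?I]) (use B W in auto)
  finally show "window_mean n k W \<phi> = window_mean n k B \<phi>" by simp
qed (rule B)

lemma has_mean_machine:
  fixes T :: "'d::finite config \<Rightarrow> 'd config"
  assumes n: "n \<ge> 1" and T: "T \<in> reversible_turing_machines n k"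
    and obs: "local_observable n k \<phi> B" "finite B" and a: "has_mean n k \<phi> a"
  shows "has_mean n k (\<lambda>c. \<phi> (T c)) a"
proof -
  obtain S where TM: "T \<in> turing_machines n k" "S \<in> turing_machines n k"
    and TS: "compose (configs n k) T S = (\<lambda>c\<in>configs n k. c)"
    and ST: "compose (configs n k) S T = (\<lambda>c\<in>configs n k. c)"
    using T unfolding reversible_turing_machines_def by blast
  have S: "S \<in> configs n k \<rightarrow> configs n k"
    using TM by (auto simp: turing_machines_def)
  have inv: "T (S c) = c" "S (T c) = c" if "c \<in> configs n k" for c
    using that fun_cong[OF TS, of c] fun_cong[OF ST, of c] by (simp_all add: compose_eq)
  obtain F M where FM: "finite F" "finite M" and win: "machine_window n k T F M"
    using machine_window_exists[OF TM(1)] by blast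
  obtain A where A: "finite A" "\<And>W. finite W \<Longrightarrow> A \<subseteq> W \<Longrightarrow> window_mean n k W \<phi> = a"
    using a unfolding has_mean_def by blast
  define W0 where "W0 = F \<union> (\<lambda>(b, u). b + u) ` (B \<times> M)"
  have "window_mean n k W (\<lambda>c. \<phi> (T c)) = a" if W: "finite W" "W0 \<subseteq> W" for W
  proof -
    define W' where "W' = A \<union> W \<union> (\<lambda>(a, u). a - u) ` (W \<times> M)"
    have "finite W'" using A FM W by (simp add: W'_def)
    moreover have "window_mean n k W (\<lambda>c. \<phi> (T c)) = window_mean n k W' \<phi>"
      by (rule window_mean_machine[OF n TM(1) S inv win obs(1)])
        (use W \<open>finite W'\<close> in \<open>auto simp: W'_def W0_def\<close>)
    ultimately show ?thesis using A(2)[of W'] by (auto simp: W'_def)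
  qed
  moreover have "finite W0" using FM obs by (simp add: W0_def)
  ultimately show ?thesis unfolding has_mean_def by blast
qed

section \<open>The drift homomorphism\<close>

definition displacement :: "'d::finite \<Rightarrow> ('d config \<Rightarrow> 'd config) \<Rightarrow> 'd config \<Rightarrow> int" where
  "displacement j T c = (snd (snd (T c)) - snd (snd c)) $ j"

lemma local_observable_displacement:
  fixes T :: "'d::finite config \<Rightarrow> 'd config"
  assumes T: "T \<in> turing_machines n k" and win: "machine_window n k T F M"
  shows "local_observable n k (displacement j T) F"
  unfolding local_observable_def
proof (intro conjI ballI allI impI)
  fix c :: "'d config" and a assume c: "c \<in> configs n k"
  have pos: "snd (snd (translate a d)) = snd (snd d) + a" for d :: "'d config"
    by (cases d) simp
  show "displacement j T (translate a c) = displacement j T c"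
    by (simp add: displacement_def machine_translate[OF T c] pos)
next
  fix x x' q
  assume c: "(x, q, 0) \<in> configs n k" "(x', q, 0) \<in> configs n k" and ag: "\<forall>b\<in>F. x b = x' b"
  obtain y q' u where "T (x, q, 0) = (y, q', u)" by (metis prod_cases3)
  with machine_window_agree[OF win order_refl c(1) this c(2)] ag
  show "displacement j T (x, q, 0) = displacement j T (x', q, 0)"
    by (simp add: displacement_def)
qed

definition drift :: "nat \<Rightarrow> nat \<Rightarrow> 'd::finite \<Rightarrow> ('d config \<Rightarrow> 'd config) \<Rightarrow> rat" where
  "drift n k j T = (THE a. has_mean n k (displacement j T) a)"

lemma drift_eqI: "has_mean n k (displacement j T) a \<Longrightarrow> drift n k j T = a"
  unfolding drift_def by (blast intro: has_mean_unique)

lemma has_mean_drift: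
  fixes T :: "'d::finite config \<Rightarrow> 'd config"
  assumes n: "n \<ge> 1" and T: "T \<in> turing_machines n k"
  shows "has_mean n k (displacement j T) (drift n k j T)"
proof -
  obtain F M where "finite F" "machine_window n k T F M"
    using machine_window_exists[OF T] by blast
  then have "\<exists>a. has_mean n k (displacement j T) a"
    using has_mean_local_observable[OF n local_observable_displacement[OF T]] by blast
  then show ?thesis using drift_eqI by blast
qed

lemma drift_rational_denominator:
  assumes n: "n \<ge> 1" and k: "k \<ge> 1" and T: "T \<in> turing_machines n k"
  shows "\<exists>D>0. of_nat D * drift n k j T \<in> \<int>"
proof -
  obtain B where B: "finite B" "window_mean n k B (displacement j T) = drift n k j T"
    using has_mean_drift[OF n T] unfolding has_mean_def by blast
  let ?D = "card (window_configs n k B)"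
  have "?D > 0" using n k B(1) by (simp add: card_window_configs)
  moreover have "of_nat ?D * drift n k j T
      = of_int (\<Sum>c\<in>window_configs n k B. displacement j T c)"
    using \<open>?D > 0\<close> by (simp add: B(2)[symmetric] window_mean_def)
  ultimately show ?thesis by (metis Ints_of_int)
qed

lemma drift_compose:
  fixes S T :: "'d::finite config \<Rightarrow> 'd config"
  assumes n: "n \<ge> 1"
    and S: "S \<in> reversible_turing_machines n k" and T: "T \<in> reversible_turing_machines n k"
  shows "drift n k j (compose (configs n k) S T) = drift n k j S + drift n k j T"
proof -
  have TM: "S \<in> turing_machines n k" "T \<in> turing_machines n k"
    using S T by (simp_all add: reversible_turing_machines_def)
  obtain F M where "finite F" "machine_window n k S F M"
    using machine_window_exists[OF TM(1)] by blast
  then have "has_mean n k (\<lambda>c. displacement j S (T c)) (drift n k j S)"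
    using has_mean_machine[OF n T local_observable_displacement[OF TM(1)]] has_mean_drift[OF n TM(1)]
    by blast
  from has_mean_add[OF this has_mean_drift[OF n TM(2)]]
  have "has_mean n k (\<lambda>c. displacement j S (T c) + displacement j T c)
      (drift n k j S + drift n k j T)" .
  then have "has_mean n k (displacement j (compose (configs n k) S T)) (drift n k j S + drift n k j T)"
    by (subst has_mean_cong[OF n]) (auto simp: displacement_def compose_eq)
  then show ?thesis by (rule drift_eqI)
qed

lemma subgroup_drift_denominator:
  fixes D n k :: nat and j :: "'d::finite"
  assumes n: "n \<ge> 1"
  defines "G \<equiv> RTM TYPE('d) n k"
  shows "subgroup {T \<in> carrier G. of_nat D * drift n k j T \<in> \<int>} G"
proof -
  interpret group G unfolding G_def by (rule group_RTM[OF n])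
  have mult: "drift n k j (S \<otimes>\<^bsub>G\<^esub> T) = drift n k j S + drift n k j T"
    if "S \<in> carrier G" "T \<in> carrier G" for S T
    using drift_compose[OF n] that by (simp add: G_def RTM_def)
  have one: "drift n k j \<one>\<^bsub>G\<^esub> = 0"
    using mult[of "\<one>\<^bsub>G\<^esub>" "\<one>\<^bsub>G\<^esub>"] by simp
  have inv: "drift n k j (inv\<^bsub>G\<^esub> T) = - drift n k j T" if "T \<in> carrier G" for T
    using mult[of T "inv\<^bsub>G\<^esub> T"] that one by simp
  show ?thesis
    by (rule subgroupI) (auto simp: one inv mult distrib_left intro!: exI[of _ "\<one>\<^bsub>G\<^esub>"])
qed

text \<open>
  A common denominator for the drifts of finitely many generators serves for the whole group, since
  the machines whose drift it clears form a subgroup.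
\<close>

lemma finitely_generated_drift_denominator:
  assumes n: "n \<ge> 1" and k: "k \<ge> 1"
    and fg: "finitely_generated_group (RTM TYPE('d::finite) n k)"
  shows "\<exists>D>0. \<forall>T\<in>reversible_turing_machines n k. of_nat D * drift n k (j :: 'd) T \<in> \<int>"
proof -
  let ?G = "RTM TYPE('d) n k"
  interpret group ?G by (rule group_RTM[OF n])
  obtain S where S: "finite S" "S \<subseteq> carrier ?G" "generate ?G S = carrier ?G"
    using fg unfolding finitely_generated_group_def by blast
  have car: "carrier ?G = reversible_turing_machines n k" by (simp add: RTM_def)
  have "\<exists>D>0. \<forall>T\<in>S. of_nat D * drift n k j T \<in> \<int>"
    using S(1,2)
  proof (induction S rule: finite_induct)
    case empty
    show ?case by auto
  next
    case (insert T S)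
    then obtain D where D: "D > 0" "\<And>U. U \<in> S \<Longrightarrow> of_nat D * drift n k j U \<in> \<int>" by auto
    obtain E where E: "E > 0" "of_nat E * drift n k j T \<in> \<int>"
      using drift_rational_denominator[OF n k, of T] insert.prems
      by (auto simp: car reversible_turing_machines_def)
    have "of_nat (D * E) * drift n k j U \<in> \<int>" if "U \<in> insert T S" for U
    proof (cases "U = T")
      case True
      have "of_nat D * (of_nat E * drift n k j T) \<in> \<int>" using E(2) by (rule Ints_mult[OF Ints_of_nat])
      then show ?thesis by (simp add: True mult_ac)
    next
      case False
      then have "of_nat D * drift n k j U \<in> \<int>" using D(2) that by simp
      then have "of_nat E * (of_nat D * drift n k j U) \<in> \<int>" by (rule Ints_mult[OF Ints_of_nat])
      then show ?thesis by (simp add: mult_ac)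
    qed
    moreover have "D * E > 0" using D E by simp
    ultimately show ?case by blast
  qed
  then obtain D where D: "D > 0" "\<And>T. T \<in> S \<Longrightarrow> of_nat D * drift n k j T \<in> \<int>" by blast
  have "generate ?G S \<subseteq> {T \<in> carrier ?G. of_nat D * drift n k j T \<in> \<int>}"
    by (rule generate_subgroup_incl[OF _ subgroup_drift_denominator[OF n]]) (use S D in auto)
  then show ?thesis using S(3) D(1) car by blast
qed

section \<open>Gliders\<close>

lemma axis_add: "axis j a + axis j b = (axis j (a + b) :: int ^ 'd::finite)"
  by (simp add: vec_eq_iff axis_def)

text \<open>
  The word consists of \<open>m\<close> cells on the axis \<open>j\<close>, starting at offset \<open>h\<close> from the head and with spacing
  \<open>s\<close>.  With \<open>s = 1\<close>, \<open>h = 0\<close> it starts at the head; the general form also covers the same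
  cells listed backwards, with \<open>s = - 1\<close> and \<open>h = m - 1\<close>, and so makes the inverse of a glider a glider.
\<close>

definition zero_word :: "'d::finite \<Rightarrow> nat \<Rightarrow> int \<Rightarrow> int \<Rightarrow> 'd tape \<Rightarrow> (int ^ 'd) \<Rightarrow> bool" where
  "zero_word j m s h x v \<longleftrightarrow> (\<forall>i<m. x (v + axis j (h + s * int i)) = 0)"

text \<open>
  Because the word is constant, moving it by one cell amounts to exchanging its first cell with the
  cell that follows it.
\<close>

fun glide :: "'d::finite \<Rightarrow> nat \<Rightarrow> int \<Rightarrow> int \<Rightarrow> 'd config \<Rightarrow> 'd config" where
  "glide j m s h (x, q, v) =
     (if zero_word j m s h x v
      then (let a = v + axis j h; b = v + axis j (h + s * int m)
            in (x(a := x b, b := x a), q, v + axis j s))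
      else (x, q, v))"

definition glider ::
  "nat \<Rightarrow> nat \<Rightarrow> 'd::finite \<Rightarrow> nat \<Rightarrow> int \<Rightarrow> int \<Rightarrow> 'd config \<Rightarrow> 'd config" where
  "glider n k j m s h = (\<lambda>c\<in>configs n k. glide j m s h c)"

lemma glide_configs: "c \<in> configs n k \<Longrightarrow> glide j m s h c \<in> configs n k"
  by (cases c) (auto simp: mem_configs Let_def)

lemma glider_turing_machine:
  fixes j :: "'d::finite"
  shows "glider n k j m s h \<in> turing_machines n k"
proof -
  define F where "F = (\<lambda>i. axis j (h + s * int i)) ` {..m}"
  define f :: "'d rule" where "f = (\<lambda>(p, q). glide j m s h (p, q, 0))"
  have F: "axis j (h + s * int i) \<in> F" if "i \<le> m" for i
    using that by (auto simp: F_def)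
  have F0: "axis j h \<in> F" using F[of 0] by simp
  have "f \<in> local_rules n k F F"
    using F[of m] F0 by (auto simp: local_rules_def f_def Let_def PiE_def Pi_def extensional_def)
  moreover have "glider n k j m s h c = apply_rule F F f c" if "c \<in> configs n k" for c
  proof -
    obtain x q v where c: "c = (x, q, v)" by (cases c)
    have "zero_word j m s h (restrict (shift (- v) x) F) 0 \<longleftrightarrow> zero_word j m s h x v"
      using F by (auto simp: zero_word_def shift_def algebra_simps)
    then show ?thesis
      using that F[of m] F0
      by (auto simp: glider_def c f_def Let_def shift_def fun_eq_iff algebra_simps)
  qed
  moreover have "glider n k j m s h \<in> configs n k \<rightarrow>\<^sub>E configs n k"
    using glide_configs by (auto simp: glider_def simp del: glide.simps)
  ultimately show ?thesis
    unfolding turing_machines_def by (auto simp: F_def intro!: exI[of _ F] exI[of _ f])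
qed

lemma zero_word_reverse:
  "zero_word j m (- s) (h + s * (int m - 1)) x v \<longleftrightarrow> zero_word j m s h x v"
proof -
  have idx: "h + s * (int m - 1) + (- s) * int i = h + s * int (m - Suc i)" if "i < m" for i
    using that by (simp add: of_nat_diff algebra_simps)
  have "m - Suc i < m" "m - Suc (m - Suc i) = i" if "i < m" for i
    using that by auto
  then have "(\<forall>i<m. P (m - Suc i)) \<longleftrightarrow> (\<forall>i<m. P i)" for P :: "nat \<Rightarrow> bool"
    by metis
  note rev = this[of "\<lambda>i. x (v + axis j (h + s * int i)) = 0"]
  show ?thesis
    unfolding zero_word_def rev[symmetric] by (rule all_cong) (simp only: idx)
qed

text \<open>
  After a step the head has the word of zeros in the same relative position, and the reversed glider
  tests exactly the same relative cells.  So it moves back if the glider has moved, and rests if it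
  has rested.
\<close>

lemma glide_reverse:
  fixes j :: "'d::finite"
  assumes "s \<noteq> 0"
  shows "glide j m (- s) (h + s * (int m - 1)) (glide j m s h c) = c"
proof -
  obtain x q v where c: "c = (x, q, v)" by (cases c)
  show ?thesis
  proof (cases "zero_word j m s h x v")
    case True
    define a b where "a = v + axis j h" and "b = v + axis j (h + s * int m)"
    define y where "y = x(a := x b, b := x a)"
    have "y (v + axis j s + axis j (h + s * int i)) = 0" if "i < m" for i
    proof -
      \<comment> \<open>The cells to be tested are the old cells number \<open>1, \<dots>, m\<close>: the exchange leaves the first
        \<open>m - 1\<close> of them as they were and puts the 0 from cell number 0 into the last.\<close>
      have pos: "v + axis j s + axis j (h + s * int i) = v + axis j (h + s * int (Suc i))"
        by (simp add: add.assoc axis_add algebra_simps)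
      have "x (v + axis j (h + s * int (Suc i))) = 0" if "Suc i < m"
        using True that unfolding zero_word_def by blast
      moreover have "x a = 0"
        using True that unfolding zero_word_def a_def by (metis add.right_neutral gr_zeroI mult_zero_right not_less0 of_nat_0)
      moreover have "v + axis j (h + s * int (Suc i)) \<noteq> a"
      proof -
        have "h + s * int (Suc i) \<noteq> h" using assms by simp
        then show ?thesis unfolding a_def by (metis add_left_cancel axis_nth)
      qed
      ultimately show ?thesis
        unfolding pos using that by (cases "Suc i = m") (auto simp: y_def b_def)
    qed
    then have "zero_word j m s h y (v + axis j s)" by (simp add: zero_word_def)
    moreover have "v + axis j s + axis j (h + s * (int m - 1)) = b"
      "v + axis j s + axis j (h + s * (int m - 1) + - s * int m) = a"
      by (simp_all add: a_def b_def add.assoc axis_add algebra_simps)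
    moreover have "v + axis j s + axis j (- s) = v"
      by (simp add: axis_def vec_eq_iff)
    moreover have "y(b := y a, a := y b) = x"
      by (auto simp: y_def)
    moreover have "glide j m s h c = (y, q, v + axis j s)"
      using True by (simp add: c y_def a_def b_def Let_def)
    ultimately show ?thesis
      by (simp add: zero_word_reverse c Let_def)
  next
    case False
    then show ?thesis by (simp add: c zero_word_reverse)
  qed
qed

lemma glider_reversible:
  fixes j :: "'d::finite"
  assumes s: "s \<noteq> 0"
  shows "glider n k j m s h \<in> reversible_turing_machines n k"
proof -
  let ?h = "h + s * (int m - 1)"
  have 1: "compose (configs n k) (glider n k j m (- s) ?h) (glider n k j m s h)
      = (\<lambda>c\<in>configs n k. c)"
    using glide_reverse[OF s, of j m h]
    by (auto simp: compose_def glider_def glide_configs fun_eq_iff simp del: glide.simps)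
  have "?h + - s * (int m - 1) = h" by simp
  then have "glide j m s h (glide j m (- s) ?h c) = c" for c
    using glide_reverse[of "- s" j m ?h c] s by simp
  then have 2: "compose (configs n k) (glider n k j m s h) (glider n k j m (- s) ?h)
      = (\<lambda>c\<in>configs n k. c)"
    by (auto simp: compose_def glider_def glide_configs fun_eq_iff simp del: glide.simps)
  show ?thesis
    unfolding reversible_turing_machines_def using 1 2 glider_turing_machine by blast
qed

lemma drift_glider:
  fixes j :: "'d::finite"
  assumes n: "n \<ge> 1" and k: "k \<ge> 1"
  shows "drift n k j (glider n k j m 1 0) = 1 / of_nat n ^ m"
proof (rule drift_eqI)
  define P where "P = (\<lambda>i. axis j (int i)) ` {..<m}"
  have finP: "finite P" by (simp add: P_def)
  have cardP: "card P = m"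
    unfolding P_def by (subst card_image) (auto simp: inj_on_def axis_eq_axis)
  have "window_mean n k W (displacement j (glider n k j m 1 0)) = 1 / of_nat n ^ m"
    if W: "finite W" "P \<subseteq> W" for W
  proof -
    let ?X = "window_configs n k W"
    let ?Z = "free_tapes n (W - P) (\<lambda>_. 0) \<times> states k \<times> {0 :: int ^ 'd}"
    have Z: "?Z = {c \<in> ?X. \<forall>a\<in>P. fst c a = 0}"
      using n W(2) by (fastforce simp: window_configs_def free_tapes_def symbols_def split: if_splits)
    have d: "displacement j (glider n k j m 1 0) c = (if c \<in> ?Z then 1 else 0)" if cX: "c \<in> ?X" for c
    proof -
      obtain x q where c: "c = (x, q, 0)" using cX by (auto simp: window_configs_def)
      have "zero_word j m 1 0 x 0 \<longleftrightarrow> c \<in> ?Z"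
        unfolding Z using cX by (auto simp: c zero_word_def P_def)
      moreover have "c \<in> configs n k" using cX window_configs_subset[OF n] by blast
      ultimately show ?thesis
        by (auto simp: displacement_def glider_def c Let_def axis_def)
    qed
    have "(\<Sum>c\<in>?X. rat_of_int (displacement j (glider n k j m 1 0) c))
        = (\<Sum>c\<in>?X. if c \<in> ?Z then 1 else 0)"
      by (rule sum.cong) (simp_all add: d)
    also have "\<dots> = of_nat (card ?Z)"
      using finite_window_configs[OF W(1)] by (simp add: Z flip: sum.inter_filter)
    also have "card ?Z = n ^ (card W - m) * k"
      using W finP by (simp add: card_cartesian_product card_free_tapes states_def card_Diff_subset cardP)
    finally have "window_mean n k W (displacement j (glider n k j m 1 0))
        = of_nat (n ^ (card W - m) * k) / of_nat (n ^ card W * k)"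
      using W(1) by (simp add: window_mean_def card_window_configs)
    moreover have "n ^ card W = n ^ (card W - m) * n ^ m"
      using card_mono[OF W] cardP by (simp flip: power_add)
    ultimately show ?thesis using n k by simp
  qed
  then show "has_mean n k (displacement j (glider n k j m 1 0)) (1 / of_nat n ^ m)"
    unfolding has_mean_def using finP by blast
qed

theorem theorem3p11:
  fixes n k :: nat
  assumes "n \<ge> 2" and "k \<ge> 1"
  shows "\<not> finitely_generated_group (RTM TYPE('d::finite) n k)"
proof
  assume fg: "finitely_generated_group (RTM TYPE('d) n k)"
  have n: "n \<ge> 1" using assms by simp
  fix j :: 'd
  obtain D where D: "D > 0"
    "\<And>T. T \<in> reversible_turing_machines n k \<Longrightarrow> of_nat D * drift n k j T \<in> \<int>"
    using finitely_generated_drift_denominator[OF n assms(2) fg] by blast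
  \<comment> \<open>Any length \<open>m\<close> with \<open>D < n ^ m\<close> works; \<open>m = D\<close> is such a length.\<close>
  have "of_nat D * drift n k j (glider n k j D 1 0) \<in> \<int>"
    by (intro D(2) glider_reversible) simp
  then obtain z :: int where z: "of_nat D / of_nat n ^ D = rat_of_int z"
    by (auto simp: drift_glider[OF n assms(2)] elim: Ints_cases)
  have "D < 2 ^ D" by (rule less_exp)
  also have "\<dots> \<le> n ^ D" using assms by (simp add: power_mono)
  finally have "rat_of_nat D < of_nat n ^ D" by (metis of_nat_less_iff of_nat_power)
  then have "rat_of_int z < 1" "rat_of_int z > 0"
    using D(1) n by (auto simp flip: z)
  then show False by simp
qed

end
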